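(* Let $(Q,* )$ be a finite medial quandle such that the relation $\sim$ on $Q$ defined by $a\sim b\Leftrightarrow a*b=a$ is an equivalence relation. Then for every positive integer $n$, the $n$-th Allen–Swenberg link $A_n$ and the connected sum of two Hopf links $L_{2H}$ satisfy $$|\mathrm{Hom}(A_n,Q)|=|\mathrm{Hom}(L_{2H},Q)|\qquad\text{and}\qquad \Phi(A_n,Q)=\Phi(L_{2H},Q).$$
   Context: A quandle is a set $Q$ with a binary operation $*$ such that $x*x=x$; for all $x,y$ there is a unique $q$ with $q*y=x$ (write $q=x*^{-1}y$); and $(x*y)*z=(x*z)*(y*z)$. It is medial if $(a_1*b_1)*(a_2*b_2)=(a_1*a_2)*(b_1*b_2)$ for all $a_1,a_2,b_1,b_2\in Q$. An arc of an oriented diagram is a maximal piece between consecutive undercrossings. At a crossing with over-arc $b$, under-arc $a$ on the left of $b$ and under-arc $c$ on the right of $b$, the crossing relation is $c=a*b$. The fundamental quandle of a link is the quandle generated by the arcs subject to all crossing relations. A coloring by $Q$ is an assignment of an element of $Q$ to each arc satisfying all crossing relations; $\mathrm{Hom}(L,Q)$ is the set of colorings (equivalently, quandle homomorphisms from the fundamental quandle of $L$ to $Q$). For finite $Q$, the enhanced coloring polynomial is $\Phi(L,Q)=\sum_{f\in \mathrm{Hom}(L,Q)}q^{|\mathrm{Im} f|}$, where $\mathrm{Im} f$ is the set of elements of $Q$ assigned by $f$ to the arcs (these invariants are diagram independent). $L_{2H}$: the connected sum of two Hopf links, with four arcs $x,y_1,y_2,z$ and crossing relations $x*y_1=x$,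 $y_2=y_1*x$, $y_1=y_2*z$, $z*y_2=z$. Tangle $T$: two strands, one from $p$ to $d$ and one from $q$ to $e$; arcs $p,q,s_1,s_2,p',q',s_3,s_4,u,v,a,b,b_1,b_2,a_1,a_2,g,h,d,e$; top ends $p$ (left), $q$ (right), bottom ends $d$ (left), $e$ (right). Its eighteen crossing relations are $b=v*u,\ u=a*b,\ s_1=p*b,\ p'*u=s_1,\ s_2*a=q,\ q'=s_2*b$; $b_1=b*a,\ b_2*q'=b_1,\ a_1*q'=a,\ a_2*b_2=a_1,\ h=b_2*p',\ g=a_2*p'$; $d=h*g,\ g=e*d,\ s_3=p'*d,\ v*g=s_3,\ s_4*e=q',\ u=s_4*d$. $A_n$ is the three-component link with the following diagram. Place $2n$ copies $T_1,\dots,T_{2n}$ of $T$ side by side (arcs of $T_i$ carry the index $i$). The middle component consists of all the $T_i$, where the bottom end $e_i$ is joined to $d_{i+1}$ (they are the same arc) for $1\le i<2n$, the two top ends of each $T_i$ are joined by a loop, and $d_1$ is joined to $e_{2n}$ by an outer bottom arc. A second component, with arcs $x_0,\dots,x_{2n+1}$, threads the $2n$ top loops, then its two ends cross once at the top, and it closes up around the outside and along the bottom. The third component, with arcs $y_1,y_2$, is a circle encircling the bottom strands of both other components. The crossing relations are those of each $T_i$ together with: for odd $i\le 2n$: $q_i=p_i*x_i$ and $x_{i-1}=x_i*p_i$; for even $i\le 2n$: $p_i=q_i*x_{i-1}$ and $x_i=x_{i-1}*q_i$; and $x_{2n+1}=x_0*x_{2n}$, $\ x_{2n+1}*y_1=x_{2n}$,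 $\ y_2*x_{2n}=y_1$, $\ y_2=y_1*d_1$, $\ e_{2n}*y_1=d_1$. *)

theory Defs
  imports "HOL-Library.FuncSet" "HOL-Computational_Algebra.Polynomial"
begin

section \<open>Quandles\<close>

locale quandle =
  fixes Q :: "'q set" and qop :: "'q \<Rightarrow> 'q \<Rightarrow> 'q"  (infixl "\<star>" 70)
  assumes closed: "\<lbrakk>x \<in> Q; y \<in> Q\<rbrakk> \<Longrightarrow> x \<star> y \<in> Q"
    and idem: "x \<in> Q \<Longrightarrow> x \<star> x = x"
    and right_invertible: "\<lbrakk>x \<in> Q; y \<in> Q\<rbrakk> \<Longrightarrow> \<exists>!q. q \<in> Q \<and> q \<star> y = x"
    and right_distrib:
      "\<lbrakk>x \<in> Q; y \<in> Q; z \<in> Q\<rbrakk> \<Longrightarrow> (x \<star> y) \<star> z = (x \<star> z) \<star> (y \<star> z)"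

locale medial_quandle = quandle +
  assumes medial:
    "\<lbrakk>a1 \<in> Q; a2 \<in> Q; b1 \<in> Q; b2 \<in> Q\<rbrakk>
      \<Longrightarrow> (a1 \<star> b1) \<star> (a2 \<star> b2) = (a1 \<star> a2) \<star> (b1 \<star> b2)"

section \<open>Diagrams and colorings\<close>

text \<open>
  A diagram is recorded by its arcs and its crossings. The crossing \<open>a \<rhd> b \<doteq> c\<close> has over-arc \<open>b\<close>,
  under-arc \<open>a\<close> on the left of \<open>b\<close> and under-arc \<open>c\<close> on the right of \<open>b\<close>; its
  crossing relation is \<open>c = a * b\<close>. Planar position is not recorded.
\<close>

datatype 'a crossing =
  Crossing (left_arc: 'a) (over_arc: 'a) (right_arc: 'a)  ("_ \<rhd> _ \<doteq> _" [51, 51, 51] 50)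

record 'a diagram =
  arcs :: "'a set"
  crossings :: "'a crossing set"

text \<open>Colorings are extensional (\<open>undefined\<close> off the arcs), so that they are determined by their
  values on the arcs.\<close>

definition colorings :: "'a diagram \<Rightarrow> 'q set \<Rightarrow> ('q \<Rightarrow> 'q \<Rightarrow> 'q) \<Rightarrow> ('a \<Rightarrow> 'q) set" where
  "colorings D Q qop =
     {f \<in> arcs D \<rightarrow>\<^sub>E Q.
        \<forall>c \<in> crossings D. f (right_arc c) = qop (f (left_arc c)) (f (over_arc c))}"

definition enhanced_coloring_poly ::
    "'a diagram \<Rightarrow> 'q set \<Rightarrow> ('q \<Rightarrow> 'q \<Rightarrow> 'q) \<Rightarrow> int poly" where
  "enhanced_coloring_poly D Q qop = (\<Sum>f\<in>colorings D Q qop. monom 1 (card (f ` arcs D)))"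

section \<open>The connected sum of two Hopf links\<close>

datatype L2H_arc = Hx | Hy1 | Hy2 | Hz

definition L2H :: "L2H_arc diagram" where
  "L2H = \<lparr> arcs = UNIV,
     crossings = {Hx \<rhd> Hy1 \<doteq> Hx, Hy1 \<rhd> Hx \<doteq> Hy2, Hy2 \<rhd> Hz \<doteq> Hy1, Hz \<rhd> Hy2 \<doteq> Hz} \<rparr>"

section \<open>The Allen--Swenberg links\<close>

datatype tangle_arc =
    Tp | Tq | Ts1 | Ts2 | Tp' | Tq' | Ts3 | Ts4 | Tu | Tv
  | Ta | Tb | Tb1 | Tb2 | Ta1 | Ta2 | Tg | Th | Td | Te

definition tangle_crossings :: "tangle_arc crossing set" where
  "tangle_crossings = {
      Tv \<rhd> Tu \<doteq> Tb, Ta \<rhd> Tb \<doteq> Tu, Tp \<rhd> Tb \<doteq> Ts1,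
      Tp' \<rhd> Tu \<doteq> Ts1, Ts2 \<rhd> Ta \<doteq> Tq, Ts2 \<rhd> Tb \<doteq> Tq',
      Tb \<rhd> Ta \<doteq> Tb1, Tb2 \<rhd> Tq' \<doteq> Tb1, Ta1 \<rhd> Tq' \<doteq> Ta,
      Ta2 \<rhd> Tb2 \<doteq> Ta1, Tb2 \<rhd> Tp' \<doteq> Th, Ta2 \<rhd> Tp' \<doteq> Tg,
      Th \<rhd> Tg \<doteq> Td, Te \<rhd> Td \<doteq> Tg, Tp' \<rhd> Td \<doteq> Ts3,
      Tv \<rhd> Tg \<doteq> Ts3, Ts4 \<rhd> Te \<doteq> Tq', Ts4 \<rhd> Td \<doteq> Tu}"

datatype AS_arc = T nat tangle_arc | X nat | Y1 | Y2

text \<open>The arc of the link containing the arc \<open>t\<close> of the \<open>i\<close>-th tangle: for \<open>i < 2 * n\<close>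
  the bottom end \<open>e\<close> of the \<open>i\<close>-th tangle is the bottom end \<open>d\<close> of the next one, so the terms
  \<open>T i Te\<close> with \<open>i < 2 * n\<close> are not arcs of the link.\<close>

definition AS_tangle_arc :: "nat \<Rightarrow> nat \<Rightarrow> tangle_arc \<Rightarrow> AS_arc" where
  "AS_tangle_arc n i t = (if t = Te \<and> i < 2 * n then T (Suc i) Td else T i t)"

definition AS_arcs :: "nat \<Rightarrow> AS_arc set" where
  "AS_arcs n =
     (\<Union>i\<in>{1..2 * n}. range (AS_tangle_arc n i)) \<union> X ` {0..2 * n + 1} \<union> {Y1, Y2}"

definition AS_crossings :: "nat \<Rightarrow> AS_arc crossing set" where
  "AS_crossings n =
     (\<Union>i\<in>{1..2 * n}. map_crossing (AS_tangle_arc n i) ` tangle_crossings)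
   \<union> (\<Union>i\<in>{i \<in> {1..2 * n}. odd i}.
        {T i Tp \<rhd> X i \<doteq> T i Tq, X i \<rhd> T i Tp \<doteq> X (i - 1)})
   \<union> (\<Union>i\<in>{i \<in> {1..2 * n}. even i}.
        {T i Tq \<rhd> X (i - 1) \<doteq> T i Tp, X (i - 1) \<rhd> T i Tq \<doteq> X i})
   \<union> {X 0 \<rhd> X (2 * n) \<doteq> X (2 * n + 1),
      X (2 * n + 1) \<rhd> Y1 \<doteq> X (2 * n),
      Y2 \<rhd> X (2 * n) \<doteq> Y1,
      Y1 \<rhd> T 1 Td \<doteq> Y2,
      T (2 * n) Te \<rhd> Y1 \<doteq> T 1 Td}"

definition allen_swenberg :: "nat \<Rightarrow> AS_arc diagram" where
  "allen_swenberg n = \<lparr> arcs = AS_arcs n, crossings = AS_crossings n \<rparr>"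

end

(* The strands of each tangle T lie in one orbit, because its top ends are related by the arc threading
   the top loop. An orbit of a medial quandle is an Alexander quandle x * y = t x + (1 - t) y, and over
   Z[t, 1/t] the relations of T force d = p and e = q, so T can be replaced by two vertical strands.
   The clasps then make d_i for odd i and x_i for even i constant, and the last crossings give
   x_0 ~ y_1 ~ d_1. Symmetry and transitivity of ~ collapse everything to a triple of pairwise related
   values, one per component, which is also what a coloring of the sum of two Hopf links is. *)

theory Submission
  imports Defs "HOL-Algebra.Free_Abelian_Groups"
begin

section \<open>Displacements of a medial quandle\<close>

context quandle
begin

text \<open>The identity off \<open>Q\<close>, so that it is a permutation of the whole type.\<close>

definition right_mult :: "'q \<Rightarrow> 'q \<Rightarrow> 'q" where
  "right_mult y x = (if x \<in> Q \<and> y \<in> Q then x \<star> y else x)"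

abbreviation right_div :: "'q \<Rightarrow> 'q \<Rightarrow> 'q" where
  "right_div y \<equiv> inv_into UNIV (right_mult y)"

lemma right_cancel: "x \<star> y = x' \<star> y \<longleftrightarrow> x = x'" if "x \<in> Q" "x' \<in> Q" "y \<in> Q"
proof
  assume eq: "x \<star> y = x' \<star> y"
  have "\<exists>!q. q \<in> Q \<and> q \<star> y = x \<star> y"
    using that by (intro right_invertible closed)
  moreover have "x \<in> Q \<and> x \<star> y = x \<star> y" "x' \<in> Q \<and> x' \<star> y = x \<star> y"
    using that eq by simp_all
  ultimately show "x = x'" by blast
qed simp

lemma right_mult_eq [simp]: "x \<in> Q \<Longrightarrow> y \<in> Q \<Longrightarrow> right_mult y x = x \<star> y"
  by (simp add: right_mult_def)

lemma right_mult_outside [simp]: "x \<notin> Q \<Longrightarrow> right_mult y x = x"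
  by (simp add: right_mult_def)

lemma right_mult_in_iff [simp]: "right_mult y x \<in> Q \<longleftrightarrow> x \<in> Q"
  by (auto simp: right_mult_def closed)

lemma bij_right_mult: "bij (right_mult y)"
proof (rule bijI)
  show "inj (right_mult y)"
    by (rule injI) (auto simp: right_mult_def right_cancel closed split: if_splits)
  have "\<exists>x. right_mult y x = z" for z
  proof (cases "z \<in> Q \<and> y \<in> Q")
    case True
    then obtain x where "x \<in> Q" "x \<star> y = z" using right_invertible by blast
    with True show ?thesis by (intro exI[of _ x]) simp
  next
    case False
    then show ?thesis by (intro exI[of _ z]) (auto simp: right_mult_def)
  qed
  then show "surj (right_mult y)"
    by (metis surjI)
qed

lemma right_div_mult [simp]: "right_div y (right_mult y x) = x"
  by (simp add: bij_right_mult bij_is_inj)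

lemma right_mult_div [simp]: "right_mult y (right_div y x) = x"
  by (simp add: bij_right_mult bij_is_surj surj_f_inv_f)

lemma right_div_in_iff [simp]: "right_div y x \<in> Q \<longleftrightarrow> x \<in> Q"
  by (metis right_mult_div right_mult_in_iff)

lemma right_div_outside [simp]: "x \<notin> Q \<Longrightarrow> right_div y x = x"
  by (metis right_div_mult right_mult_outside)

lemma right_mult_inject [simp]: "right_mult y x = right_mult y x' \<longleftrightarrow> x = x'"
  by (metis right_div_mult)

lemma right_mult_distrib:
  assumes "y \<in> Q" "z \<in> Q"
  shows "right_mult z (right_mult y x) = right_mult (right_mult z y) (right_mult z x)"
  using assms right_distrib[of x y z] by (cases "x \<in> Q") (simp_all add: closed)

lemma right_mult_distrib_div:
  assumes "y \<in> Q" "z \<in> Q"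
  shows "right_mult z (right_div y x) = right_div (right_mult z y) (right_mult z x)"
  by (metis assms right_div_mult right_mult_distrib right_mult_div)

text \<open>The displacement (transvection) group. The inverse of a generator is again a generator,
  so closing \<open>id\<close> under composition with generators yields a group. The group generated
  by all right translations would be too large: mediality makes only this one commutative.\<close>

inductive_set displacements :: "('q \<Rightarrow> 'q) set" where
  id: "id \<in> displacements"
| step: "\<lbrakk>a \<in> Q; b \<in> Q; \<delta> \<in> displacements\<rbrakk>
    \<Longrightarrow> right_mult a \<circ> right_div b \<circ> \<delta> \<in> displacements"

lemma displacement_gen: "a \<in> Q \<Longrightarrow> b \<in> Q \<Longrightarrow> right_mult a \<circ> right_div b \<in> displacements"
  using displacements.step[OF _ _ displacements.id] by simp

lemma displacement_comp:
  assumes "\<delta> \<in> displacements" "\<epsilon> \<in> displacements"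
  shows "\<delta> \<circ> \<epsilon> \<in> displacements"
  using assms by induction (simp_all add: displacements.step[unfolded comp_assoc] comp_assoc)

lemma displacement_left_inverse:
  assumes "\<delta> \<in> displacements"
  shows "\<exists>\<epsilon>\<in>displacements. \<epsilon> \<circ> \<delta> = id"
  using assms
proof induction
  case (step a b \<delta>)
  then obtain \<epsilon> where "\<epsilon> \<in> displacements" "\<epsilon> \<circ> \<delta> = id" by blast
  moreover have "\<epsilon> \<circ> (right_mult b \<circ> right_div a) \<circ> (right_mult a \<circ> right_div b \<circ> \<delta>) = \<epsilon> \<circ> \<delta>"
    by (simp add: fun_eq_iff)
  ultimately show ?case
    using displacement_comp displacement_gen step.hyps by metis
qed (rule bexI[of _ id], simp_all add: displacements.id)

lemma displacement_in:
  assumes "\<delta> \<in> displacements" shows "\<delta> x \<in> Q \<longleftrightarrow> x \<in> Q"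
  using assms by (induction arbitrary: x) auto

text \<open>Right distributivity makes every right translation an automorphism, hence also its
  inverse and all composites.\<close>

lemma displacement_distrib:
  assumes "\<delta> \<in> displacements" "y \<in> Q"
  shows "\<delta> (right_mult y x) = right_mult (\<delta> y) (\<delta> x)"
  using assms
proof (induction arbitrary: x)
  case (step a b \<delta>)
  have "right_div b (right_mult v w) = right_mult (right_div b v) (right_div b w)" if "v \<in> Q" for v w
    using right_mult_distrib[of "right_div b v" b "right_div b w"] that step.hyps
    by (metis right_div_in_iff right_div_mult right_mult_div)
  with step show ?case
    by (simp add: displacement_in right_mult_distrib[of _ a] del: right_mult_eq)
qed simp

text \<open>Conjugation by the translation of \<open>p\<close> replaces \<open>a\<close> and
  \<open>b\<close> in a generator by their products with \<open>p\<close>. This conjugation later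
  plays the part of the Alexander variable t.\<close>

lemma displacement_conj:
  assumes "\<delta> \<in> displacements" "p \<in> Q"
  shows "right_mult p \<circ> \<delta> \<circ> right_div p \<in> displacements"
  using assms
proof induction
  case id
  then show ?case
    using displacements.id by (simp add: comp_def id_def)
next
  case (step a b \<delta>)
  have "right_mult p \<circ> (right_mult a \<circ> right_div b \<circ> \<delta>) \<circ> right_div p =
      right_mult (right_mult p a) \<circ> right_div (right_mult p b) \<circ> (right_mult p \<circ> \<delta> \<circ> right_div p)"
    using step by (simp add: fun_eq_iff right_mult_distrib[of _ p] right_mult_distrib_div
        del: right_mult_eq)
  with step show ?case
    by (metis displacements.step right_mult_in_iff)
qed

definition orbit :: "'q \<Rightarrow> 'q set" where
  "orbit p = {\<delta> p | \<delta>. \<delta> \<in> displacements}"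

lemma orbitI: "\<delta> \<in> displacements \<Longrightarrow> \<delta> p = x \<Longrightarrow> x \<in> orbit p"
  by (auto simp: orbit_def)

lemma orbit_refl: "p \<in> orbit p"
  by (rule orbitI[OF displacements.id]) simp

lemma orbit_subset: "p \<in> Q \<Longrightarrow> orbit p \<subseteq> Q"
  by (auto simp: orbit_def displacement_in)

text \<open>By idempotence, dividing \<open>x\<close> by itself changes nothing, so multiplication
  of \<open>x\<close> by \<open>y\<close> is the effect of a generator. Note that \<open>y\<close>
  may be any element of \<open>Q\<close>: orbits are constant along a strand whatever passes over
  it.\<close>

lemma orbit_mult_iff:
  assumes p: "p \<in> Q" and x: "x \<in> Q" and y: "y \<in> Q"
  shows "x \<star> y \<in> orbit p \<longleftrightarrow> x \<in> orbit p"
proof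
  assume "x \<in> orbit p"
  then obtain \<delta> where \<delta>: "\<delta> \<in> displacements" "\<delta> p = x"
    by (auto simp: orbit_def)
  have "right_div x x = x"
    by (metis idem right_div_mult right_mult_eq x)
  then have "(right_mult y \<circ> right_div x \<circ> \<delta>) p = x \<star> y"
    using \<delta> x y by simp
  then show "x \<star> y \<in> orbit p"
    by (rule orbitI[OF displacements.step[OF y x \<delta>(1)]])
next
  assume "x \<star> y \<in> orbit p"
  then obtain \<delta> where \<delta>: "\<delta> \<in> displacements" "\<delta> p = x \<star> y"
    by (auto simp: orbit_def)
  have "(right_mult x \<circ> right_div y \<circ> \<delta>) p = x"
    using \<delta> x y by (metis comp_apply idem right_div_mult right_mult_eq)
  then show "x \<in> orbit p"
    by (rule orbitI[OF displacements.step[OF x y \<delta>(1)]])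
qed

end

section \<open>Commutativity of displacements and the linear model of an orbit\<close>

context medial_quandle
begin

text \<open>With R_y for \<open>right_mult y\<close>, this is the medial law in the form R_a R_b^-1
  R_c = R_c R_b^-1 R_a: composing with R_b and distributing turns the two sides into the two sides
  of mediality.\<close>

lemma right_mult_div_commute:
  assumes a: "a \<in> Q" and b: "b \<in> Q" and c: "c \<in> Q"
  shows "right_mult a (right_div b (right_mult c x)) = right_mult c (right_div b (right_mult a x))"
proof (cases "x \<in> Q")
  case True
  have *: "right_mult b (right_mult u (right_div b (right_mult v x)))
      = right_mult (right_mult b u) (right_mult v x)" if "u \<in> Q" for u v
    using right_mult_distrib[of u b "right_div b (right_mult v x)"] that b by simp
  have "right_mult (right_mult b a) (right_mult c x) = right_mult (right_mult b c) (right_mult a x)"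
    using medial[of x a c b] a b c True by (simp add: closed)
  with *[OF a, of c] *[OF c, of a] show ?thesis
    by (metis right_mult_inject)
qed simp

lemma right_div_mult_commute:
  assumes a: "a \<in> Q" and b: "b \<in> Q" and c: "c \<in> Q"
  shows "right_div a (right_mult b (right_div c x)) = right_div c (right_mult b (right_div a x))"
  using right_mult_div_commute[OF a b c, of "right_div c (right_mult b (right_div a x))"]
  by (metis right_div_mult right_mult_div)

text \<open>In R_a R_b^-1 R_c R_d^-1 the two exchange rules above swap first a with c, then b with
  d.\<close>

lemma displacement_gen_commute:
  assumes "\<delta> \<in> displacements" "a \<in> Q" "b \<in> Q"
  shows "right_mult a (right_div b (\<delta> x)) = \<delta> (right_mult a (right_div b x))"
  using assms
proof (induction arbitrary: x)
  case (step c d \<delta>)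
  show ?case
    using step right_mult_div_commute[of a b c] right_div_mult_commute[of b a d] by simp
qed simp

lemma displacement_commute:
  assumes "\<delta> \<in> displacements" "\<epsilon> \<in> displacements"
  shows "\<delta> \<circ> \<epsilon> = \<epsilon> \<circ> \<delta>"
  using assms
  by induction (simp_all add: fun_eq_iff displacement_gen_commute)

definition displacement_group :: "('a \<Rightarrow> 'a) monoid" where
  "displacement_group = \<lparr>carrier = displacements, monoid.mult = (\<circ>), one = id\<rparr>"

lemma displacement_group_simps [simp]:
  "carrier displacement_group = displacements"
  "\<delta> \<otimes>\<^bsub>displacement_group\<^esub> \<epsilon> = \<delta> \<circ> \<epsilon>"
  "\<one>\<^bsub>displacement_group\<^esub> = id"
  by (simp_all add: displacement_group_def)

lemma comm_group_displacement_group: "comm_group displacement_group"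
  by (rule groupI[THEN group.group_comm_groupI])
    (auto simp: displacement_comp displacements.id comp_assoc displacement_left_inverse
      intro: displacement_commute)

text \<open>An orbit is a torsor under a quotient of the displacement group, on which conjugation by
  \<open>p\<close> acts as the variable of an Alexander module. Pulling this back along the free abelian group on
  the displacements turns equations between points of the orbit into congruences modulo the
  subgroup \<open>N\<close> (the preimage of the stabilizer of \<open>p\<close>) in a type of class \<open>ab_group_add\<close>.\<close>

lemma orbit_linearization:
  assumes p: "p \<in> Q"
  obtains \<iota> :: "'a \<Rightarrow> ('a \<Rightarrow> 'a) \<Rightarrow>\<^sub>0 int" and T N where
    "\<And>a b. T (a + b) = T a + T b" "\<And>a b. T (a - b) = T a - T b"
    "\<And>a b. a \<in> N \<Longrightarrow> b \<in> N \<Longrightarrow> a + b \<in> N" "\<And>a b. a \<in> N \<Longrightarrow> b \<in> N \<Longrightarrow> a - b \<in> N"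
    "\<And>a. T a \<in> N \<longleftrightarrow> a \<in> N"
    "\<And>x y. x \<in> orbit p \<Longrightarrow> y \<in> orbit p \<Longrightarrow> T (\<iota> x) + \<iota> y - T (\<iota> y) - \<iota> (x \<star> y) \<in> N"
    "\<And>x y. x \<in> orbit p \<Longrightarrow> y \<in> orbit p \<Longrightarrow> \<iota> x - \<iota> y \<in> N \<Longrightarrow> x = y"
proof -
  define conj where "conj \<delta> = right_mult p \<circ> \<delta> \<circ> right_div p" for \<delta>
  \<comment> \<open>The free abelian group is taken on all maps, so that it fills the whole type;
    \<open>cut\<close> gives the maps that are not displacements a harmless image.\<close>
  define cut where "cut \<delta> = (if \<delta> \<in> displacements then \<delta> else id)" for \<delta>
  interpret G: comm_group displacement_group
    by (rule comm_group_displacement_group)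
  obtain h where h: "h \<in> hom (free_Abelian_group UNIV) displacement_group"
    and h_of: "\<And>\<delta>. h (frag_of \<delta>) = cut \<delta>"
  proof (rule G.free_Abelian_group_universal[of cut UNIV])
    show "cut ` UNIV \<subseteq> carrier displacement_group"
      by (auto simp: cut_def displacements.id)
  qed simp
  interpret h: group_hom "free_Abelian_group UNIV" displacement_group h
    by (simp add: group_hom_def group_hom_axioms_def h)
  have h_add: "h (a + b) = h a \<circ> h b" for a b
    using h.hom_mult[of a b] by simp
  have h_0: "h 0 = id"
    using h.hom_one by simp
  have h_diff: "h (a - b) \<circ> h b = h a" for a b
    using h_add[of "a - b" b] by simp
  have inj_h: "h c x = h c y \<longleftrightarrow> x = y" for c x y
    using h_add[of "- c" c] h_0 by (metis comp_apply eq_id_iff left_minus)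
  have cut_in: "cut \<delta> \<in> displacements" for \<delta>
    by (simp add: cut_def displacements.id)
  have conj_p: "conj \<delta> p = right_mult p (\<delta> p)" for \<delta>
    unfolding conj_def by (metis comp_apply idem p right_div_mult right_mult_eq)
  have conj_comp: "conj (\<delta> \<circ> \<epsilon>) = conj \<delta> \<circ> conj \<epsilon>" for \<delta> \<epsilon>
    by (simp add: conj_def fun_eq_iff)
  define T where "T = frag_extend (\<lambda>\<delta>. frag_of (conj (cut \<delta>)))"
  have hT: "h (T c) = conj (h c)" for c
  proof -
    have "Poly_Mapping.keys c \<subseteq> UNIV" by simp
    then show ?thesis
    proof (induction rule: frag_induction)
      case zero
      then show ?case
        by (simp add: T_def h_0 conj_def fun_eq_iff)
    next
      case (one \<delta>)
      then show ?case
        using displacement_conj[OF cut_in p]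
        by (simp add: T_def h_of) (simp add: cut_def conj_def)
    next
      \<comment> \<open>\<open>frag_induction\<close> supplies differences, so \<open>T b\<close> is
        added on both sides and the invertible map \<open>h (T b)\<close> is cancelled.\<close>
      case (diff a b)
      have "h (T (a - b)) \<circ> h (T b) = h (T a)"
        by (simp add: T_def frag_extend_diff h_diff)
      also have "\<dots> = conj (h (a - b)) \<circ> conj (h b)"
        by (simp add: diff h_diff flip: conj_comp)
      finally have "h (T (a - b)) \<circ> h (T b) = conj (h (a - b)) \<circ> h (T b)"
        by (simp add: diff)
      moreover have "h (T b) \<circ> h (- T b) = id"
        using h_add[of "T b" "- T b"] h_0 by simp
      ultimately show ?case
        by (metis comp_assoc comp_id)
    qed
  qed
  \<comment> \<open>Any displacement taking \<open>p\<close> to \<open>x\<close> will do: two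
    choices differ by an element of the stabilizer of \<open>p\<close>.\<close>
  define \<tau> where "\<tau> x = (SOME \<delta>. \<delta> \<in> displacements \<and> \<delta> p = x)" for x
  have \<tau>: "\<tau> x \<in> displacements \<and> \<tau> x p = x" if "x \<in> orbit p" for x
    unfolding \<tau>_def
    by (rule someI_ex[of "\<lambda>\<delta>. \<delta> \<in> displacements \<and> \<delta> p = x"])
      (use that in \<open>auto simp: orbit_def\<close>)
  define \<iota> where "\<iota> x = frag_of (\<tau> x)" for x
  have h\<iota>: "h (\<iota> x) = \<tau> x" if "x \<in> orbit p" for x
    using \<tau>[OF that] by (simp add: \<iota>_def h_of cut_def)
  define N where "N = {c. h c p = p}"
  \<comment> \<open>Since a = b + (a - b) and \<open>h b\<close> is injective, congruences modulo
    \<open>N\<close> can be checked as equalities of points.\<close>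
  have diff_N: "a - b \<in> N \<longleftrightarrow> h a p = h b p" for a b
  proof -
    have "h a p = h (b + (a - b)) p"
      by simp
    also have "\<dots> = h b (h (a - b) p)"
      by (simp only: h_add comp_apply)
    finally show ?thesis
      by (auto simp: N_def inj_h)
  qed
  show thesis
  proof
    fix a b
    show "T (a + b) = T a + T b" "T (a - b) = T a - T b"
      by (simp_all add: T_def frag_extend_add frag_extend_diff)
    show "T a \<in> N \<longleftrightarrow> a \<in> N"
      using right_mult_inject[of p "h a p" p] by (simp add: N_def hT conj_p idem p)
    show "a + b \<in> N" "a - b \<in> N" if "a \<in> N" "b \<in> N"
      using that by (simp_all add: diff_N) (simp_all add: N_def h_add)
  next
    fix x y assume x: "x \<in> orbit p" and y: "y \<in> orbit p"
    then have xy: "x \<star> y \<in> orbit p" "x \<in> Q" "y \<in> Q"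
      using orbit_mult_iff orbit_subset p by blast+
    show "x = y" if "\<iota> x - \<iota> y \<in> N"
      using that \<tau> x y by (auto simp: diff_N h\<iota>)
    \<comment> \<open>As \<tau> y is an automorphism taking \<open>p\<close> to \<open>y\<close>,
      conjugating the translation of \<open>p\<close> by \<tau> y gives the translation of
      \<open>y\<close>. Written additively, the product is \<iota> y + T (\<iota> x - \<iota>
      y).\<close>
    have "h (T (\<iota> x) + \<iota> y - T (\<iota> y)) p = \<tau> (x \<star> y) p"
    proof -
      have "h (T (\<iota> x) + \<iota> y - T (\<iota> y)) p = h (\<iota> y + T (\<iota> x - \<iota> y)) p"
        by (simp add: T_def frag_extend_diff algebra_simps)
      also have "\<dots> = \<tau> y (right_mult p (h (\<iota> x - \<iota> y) p))"
        by (simp only: h_add hT conj_p h\<iota>[OF y] comp_apply)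
      also have "\<dots> = right_mult y (\<tau> y (h (\<iota> x - \<iota> y) p))"
        using \<tau>[OF y] p by (simp only: displacement_distrib)
      also have "\<tau> y (h (\<iota> x - \<iota> y) p) = h (\<iota> y + (\<iota> x - \<iota> y)) p"
        by (simp only: h_add h\<iota>[OF y] comp_apply)
      also have "\<dots> = x"
        using \<tau>[OF x] by (simp add: h\<iota>[OF x])
      finally show ?thesis
        using \<tau>[OF xy(1)] xy by simp
    qed
    then show "T (\<iota> x) + \<iota> y - T (\<iota> y) - \<iota> (x \<star> y) \<in> N"
      by (simp add: diff_N h\<iota>[OF xy(1)])
  qed
qed

end

section \<open>The tangle\<close>

context medial_quandle
begin

lemma tangle_ends:
  fixes f :: "tangle_arc \<Rightarrow> 'a"
  assumes f: "\<And>t. f t \<in> Q"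
    and rel: "\<And>c. c \<in> tangle_crossings \<Longrightarrow> f (right_arc c) = f (left_arc c) \<star> f (over_arc c)"
    and q: "f Tq \<in> orbit (f Tp)"
  shows "f Td = f Tp" "f Te = f Tq"
proof -
  let ?O = "orbit (f Tp)"
  have rel: "f z = f x \<star> f y" if "(x \<rhd> y \<doteq> z) \<in> tangle_crossings" for x y z
    using rel[OF that] by simp
  then have orb: "f z \<in> ?O \<longleftrightarrow> f x \<in> ?O" if "(x \<rhd> y \<doteq> z) \<in> tangle_crossings" for x y z
    using orbit_mult_iff[of "f Tp"] f that by simp
  \<comment> \<open>The two under-arcs at a crossing lie on one strand, so membership spreads from
    the top ends along both strands.\<close>
  have orbs: "f Tb \<in> ?O \<longleftrightarrow> f Tv \<in> ?O" "f Tu \<in> ?O \<longleftrightarrow> f Ta \<in> ?O" "f Ts1 \<in> ?O \<longleftrightarrow> f Tp \<in> ?O"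
      "f Ts1 \<in> ?O \<longleftrightarrow> f Tp' \<in> ?O" "f Tq \<in> ?O \<longleftrightarrow> f Ts2 \<in> ?O" "f Tq' \<in> ?O \<longleftrightarrow> f Ts2 \<in> ?O"
      "f Tb1 \<in> ?O \<longleftrightarrow> f Tb \<in> ?O" "f Tb1 \<in> ?O \<longleftrightarrow> f Tb2 \<in> ?O" "f Ta \<in> ?O \<longleftrightarrow> f Ta1 \<in> ?O"
      "f Ta1 \<in> ?O \<longleftrightarrow> f Ta2 \<in> ?O" "f Th \<in> ?O \<longleftrightarrow> f Tb2 \<in> ?O" "f Tg \<in> ?O \<longleftrightarrow> f Ta2 \<in> ?O"
      "f Td \<in> ?O \<longleftrightarrow> f Th \<in> ?O" "f Tg \<in> ?O \<longleftrightarrow> f Te \<in> ?O" "f Ts3 \<in> ?O \<longleftrightarrow> f Tp' \<in> ?O"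
      "f Ts3 \<in> ?O \<longleftrightarrow> f Tv \<in> ?O" "f Tq' \<in> ?O \<longleftrightarrow> f Ts4 \<in> ?O" "f Tu \<in> ?O \<longleftrightarrow> f Ts4 \<in> ?O"
    by (rule orb, simp add: tangle_crossings_def)+
  have orb': "f t \<in> ?O" for t
    by (cases t) (metis orbs q orbit_refl)+
  obtain \<iota> :: "'a \<Rightarrow> ('a \<Rightarrow> 'a) \<Rightarrow>\<^sub>0 int" and T N where
    T: "\<And>a b. T (a + b) = T a + T b" "\<And>a b. T (a - b) = T a - T b" and
    N: "\<And>a b. a \<in> N \<Longrightarrow> b \<in> N \<Longrightarrow> a + b \<in> N" "\<And>a b. a \<in> N \<Longrightarrow> b \<in> N \<Longrightarrow> a - b \<in> N"
      "\<And>a. T a \<in> N \<longleftrightarrow> a \<in> N" and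
    mult: "\<And>x y. x \<in> ?O \<Longrightarrow> y \<in> ?O \<Longrightarrow> T (\<iota> x) + \<iota> y - T (\<iota> y) - \<iota> (x \<star> y) \<in> N" and
    inj: "\<And>x y. x \<in> ?O \<Longrightarrow> y \<in> ?O \<Longrightarrow> \<iota> x - \<iota> y \<in> N \<Longrightarrow> x = y"
    by (rule orbit_linearization[OF f[of Tp]]) (rule that)
  \<comment> \<open>The defect of a crossing relation in the linear model; it lies in
    \<open>N\<close> exactly because the relation holds in the orbit.\<close>
  define r where "r x y z = T (\<iota> (f x)) + \<iota> (f y) - T (\<iota> (f y)) - \<iota> (f z)" for x y z
  have r: "r x y z \<in> N" if "(x \<rhd> y \<doteq> z) \<in> tangle_crossings" for x y z
    using mult[OF orb'[of x] orb'[of y]] rel[OF that] by (simp add: r_def)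
  have r_in: "r Tv Tu Tb \<in> N" "r Ta Tb Tu \<in> N" "r Tp Tb Ts1 \<in> N"
      "r Tp' Tu Ts1 \<in> N" "r Ts2 Ta Tq \<in> N" "r Ts2 Tb Tq' \<in> N"
      "r Tb Ta Tb1 \<in> N" "r Tb2 Tq' Tb1 \<in> N" "r Ta1 Tq' Ta \<in> N"
      "r Ta2 Tb2 Ta1 \<in> N" "r Tb2 Tp' Th \<in> N" "r Ta2 Tp' Tg \<in> N"
      "r Th Tg Td \<in> N" "r Te Td Tg \<in> N" "r Tp' Td Ts3 \<in> N"
      "r Tv Tg Ts3 \<in> N" "r Ts4 Te Tq' \<in> N" "r Ts4 Td Tu \<in> N"
    by (rule r, simp add: tangle_crossings_def)+
  \<comment> \<open>The coefficients of this combination and the next come from Gaussian elimination over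
    \<open>\<int>[t, 1/t]\<close>, multiplied by a power of \<open>t\<close> to clear denominators.\<close>
  have "T (\<iota> (f Tp) - \<iota> (f Td)) =
      T (r Tv Tu Tb + r Ta Tb Tu + r Tb Ta Tb1 - r Tb2 Tq' Tb1 + r Tb2 Tp' Th
         - r Te Td Tg - r Te Td Tg + T (r Te Td Tg)
         + r Tp' Td Ts3 - r Tv Tg Ts3
         + T (r Ts4 Te Tq') - r Ts4 Te Tq' + r Ts4 Td Tu - T (r Ts4 Td Tu))
      + (r Tp Tb Ts1 - r Ta Tb Tu - r Tp' Tu Ts1 + r Th Tg Td + r Te Td Tg)"
    by (simp add: r_def T algebra_simps)
  then have "T (\<iota> (f Tp) - \<iota> (f Td)) \<in> N"
    by (simp only: N r_in)
  \<comment> \<open>\<open>N(3)\<close> strips the factor \<open>T\<close>, which is injective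
    modulo \<open>N\<close>.\<close>
  then show d: "f Td = f Tp"
    using N(3) inj[OF orb'[of Tp] orb'[of Td]] by simp
  \<comment> \<open>The terms in \<open>f Td\<close> and \<open>f Tp\<close> cancel only against
    each other, so the equality \<open>d\<close> just shown enters this identity.\<close>
  have "T (T (\<iota> (f Te) - \<iota> (f Tq))) =
      T (T (r Ta Tb Tu + r Ts2 Ta Tq - r Ts2 Tb Tq' + r Ta2 Tb2 Ta1 + r Tb2 Tp' Th - r Ta2 Tp' Tg)
         - r Ta Tb Tu + r Tp Tb Ts1 - r Tp' Tu Ts1 + r Ta1 Tq' Ta - r Tb2 Tp' Th
         + r Th Tg Td + r Te Td Tg + r Te Td Tg + r Ts4 Te Tq' - r Ts4 Td Tu)
      + (r Ta Tb Tu - r Tp Tb Ts1 + r Tp' Tu Ts1 - r Th Tg Td - r Te Td Tg)"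
    by (simp add: r_def T d algebra_simps)
  then have "T (T (\<iota> (f Te) - \<iota> (f Tq))) \<in> N"
    by (simp only: N r_in)
  then show "f Te = f Tq"
    using N(3) inj[OF orb'[of Te] orb'[of Tq]] by simp
qed

text \<open>Complements \<open>tangle_ends\<close>, which controls only the ends: the inner arcs
  must not contribute further values to the image of a coloring. Idempotence and right cancellation
  settle the arcs one after another.\<close>

lemma tangle_constant:
  fixes f :: "tangle_arc \<Rightarrow> 'a"
  assumes f: "\<And>t. f t \<in> Q"
    and rel: "\<And>c. c \<in> tangle_crossings \<Longrightarrow> f (right_arc c) = f (left_arc c) \<star> f (over_arc c)"
    and ends: "f Tp = p" "f Tq = p" "f Td = p" "f Te = p"
  shows "f t = p"
proof -
  have rel: "f z = f x \<star> f y" if "(x \<rhd> y \<doteq> z) \<in> tangle_crossings" for x y z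
    using rel[OF that] by simp
  note inj = right_cancel[OF f f f]
  have p: "p \<in> Q" using f ends by metis
  have r: "f Tb = f Tv \<star> f Tu" "f Tu = f Ta \<star> f Tb" "f Ts1 = f Tp \<star> f Tb"
      "f Ts1 = f Tp' \<star> f Tu" "f Tq = f Ts2 \<star> f Ta" "f Tq' = f Ts2 \<star> f Tb"
      "f Tb1 = f Tb \<star> f Ta" "f Tb1 = f Tb2 \<star> f Tq'" "f Ta = f Ta1 \<star> f Tq'"
      "f Ta1 = f Ta2 \<star> f Tb2" "f Th = f Tb2 \<star> f Tp'" "f Tg = f Ta2 \<star> f Tp'"
      "f Td = f Th \<star> f Tg" "f Tg = f Te \<star> f Td" "f Ts3 = f Tp' \<star> f Td"
      "f Ts3 = f Tv \<star> f Tg" "f Tq' = f Ts4 \<star> f Te" "f Tu = f Ts4 \<star> f Td"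
    by (rule rel, simp add: tangle_crossings_def)+
  have g: "f Tg = p" using r(14) ends p by (simp add: idem)
  have v: "f Tv = f Tp'" using r(15,16) g ends inj[of Tv Td Tp'] by simp
  \<comment> \<open>The relations at s_1 and b give p * b = p' * u = v * u = b = b * b.\<close>
  have b: "f Tb = p" using r(1,3,4) v ends inj[of Tb Tb Tp] idem[OF f[of Tb]] by simp
  have q': "f Tq' = f Tu" using r(17,18) ends by simp
  \<comment> \<open>Both a * b and s_2 * b equal q', so q = s_2 * a becomes q = a * a.\<close>
  have "f Ta = f Ts2" using r(2,6) q' inj[of Ta Tb Ts2] by simp
  then have a: "f Ta = p" "f Ts2 = p" using r(5) ends idem[OF f[of Ta]] by simp_all
  have u: "f Tu = p" "f Tq' = p" using r(2) q' a b p by (simp_all add: idem)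
  have p': "f Tp' = p" "f Ts1 = p" "f Tv = p"
    using r(3,4) v b u p ends inj[of Tp' Tu Tp] by (simp_all add: idem)
  have b2: "f Tb1 = p" "f Tb2 = p"
    using r(7,8) a b u p ends inj[of Tb2 Tq' Tp] by (simp_all add: idem)
  have a1: "f Ta1 = p" using r(9) a u p ends inj[of Ta1 Tq' Tp] by (simp add: idem)
  have a2: "f Ta2 = p" using r(12) g p' p ends inj[of Ta2 Tp' Tp] by (simp add: idem)
  have h: "f Th = p" using r(11) b2 p' p by (simp add: idem)
  have s: "f Ts3 = p" "f Ts4 = p"
    using r(15,18) p' u p ends inj[of Ts4 Td Tp] by (simp_all add: idem)
  show ?thesis
    using ends g b a u p' b2 a1 a2 h s by (cases t) simp_all
qed

end

section \<open>Colorings of the two links\<close>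

lemma coloring_in:
  assumes "f \<in> colorings D Q qop" "a \<in> arcs D"
  shows "f a \<in> Q"
  using assms unfolding colorings_def by blast

lemma coloring_crossing:
  assumes "f \<in> colorings D Q qop" "(a \<rhd> b \<doteq> c) \<in> crossings D"
  shows "f c = qop (f a) (f b)"
proof -
  have "\<forall>c\<in>crossings D. f (right_arc c) = qop (f (left_arc c)) (f (over_arc c))"
    using assms(1) by (simp add: colorings_def)
  from bspec[OF this assms(2)] show ?thesis
    by (simp only: crossing.sel)
qed

section \<open>Arcs and components of the Allen-Swenberg links\<close>

lemma tangle_arc_in_AS_arcs: "i \<in> {1..2 * n} \<Longrightarrow> AS_tangle_arc n i t \<in> AS_arcs n"
  unfolding AS_arcs_def by blast

lemma X_Y_in_AS_arcs:
  "i \<le> 2 * n + 1 \<Longrightarrow> X i \<in> AS_arcs n" "Y1 \<in> AS_arcs n" "Y2 \<in> AS_arcs n"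
  by (simp_all add: AS_arcs_def)

lemma T_1_Td_in_AS_arcs: "n > 0 \<Longrightarrow> T 1 Td \<in> AS_arcs n"
  using tangle_arc_in_AS_arcs[of 1 n Td] by (simp add: AS_tangle_arc_def)

lemma AS_arcs_cases:
  assumes "a \<in> AS_arcs n"
  obtains i t where "i \<in> {1..2 * n}" "a = AS_tangle_arc n i t"
    | i where "i \<le> 2 * n + 1" "a = X i"
    | "a = Y1" | "a = Y2"
  using assms unfolding AS_arcs_def by (elim UnE UN_E imageE rangeE insertE emptyE) auto

text \<open>The encircling circle corresponds to the middle component of the connected sum. Its two
  arcs keep distinct images, so a coloring can be recovered from its pullback without using crossing
  relations.\<close>

fun component :: "AS_arc \<Rightarrow> L2H_arc" where
  "component (T i t) = Hz"
| "component (X i) = Hx"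
| "component Y1 = Hy1"
| "component Y2 = Hy2"

lemma component_AS_tangle_arc [simp]: "component (AS_tangle_arc n i t) = Hz"
  by (simp add: AS_tangle_arc_def)

lemma AS_coloring_tangle:
  assumes "k \<in> colorings (allen_swenberg n) Q qop" "i \<in> {1..2 * n}" "c \<in> tangle_crossings"
  shows "k (AS_tangle_arc n i (right_arc c)) =
    qop (k (AS_tangle_arc n i (left_arc c))) (k (AS_tangle_arc n i (over_arc c)))"
proof -
  obtain x y z where c: "c = (x \<rhd> y \<doteq> z)" by (cases c)
  have "map_crossing (AS_tangle_arc n i) c \<in> crossings (allen_swenberg n)"
    using assms(2,3) unfolding allen_swenberg_def AS_crossings_def by auto
  from coloring_crossing[OF assms(1) this[unfolded c crossing.map]] show ?thesis
    by (simp only: c crossing.sel)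
qed

section \<open>Values taken by the colorings\<close>

context medial_quandle
begin

lemma fixed_sym:
  assumes "equiv Q {(a, b). a \<in> Q \<and> b \<in> Q \<and> a \<star> b = a}"
    and "a \<star> b = a" "a \<in> Q" "b \<in> Q"
  shows "b \<star> a = b"
proof -
  have "sym {(a, b). a \<in> Q \<and> b \<in> Q \<and> a \<star> b = a}"
    using assms(1) by (rule equivE)
  from symD[OF this, of a b] show ?thesis
    using assms(2-4) by simp
qed

lemma fixed_trans:
  assumes "equiv Q {(a, b). a \<in> Q \<and> b \<in> Q \<and> a \<star> b = a}"
    and "a \<star> b = a" "b \<star> c = b" "a \<in> Q" "b \<in> Q" "c \<in> Q"
  shows "a \<star> c = a"
proof -
  have "trans {(a, b). a \<in> Q \<and> b \<in> Q \<and> a \<star> b = a}"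
    using assms(1) by (rule equivE)
  from transD[OF this, of a b c] show ?thesis
    using assms(2-6) by simp
qed

text \<open>Every value is fixed by that of y_1, and symmetry and transitivity then relate any two
  values through y_1.\<close>

lemma L2H_coloring:
  assumes equiv: "equiv Q {(a, b). a \<in> Q \<and> b \<in> Q \<and> a \<star> b = a}"
    and f: "f \<in> colorings L2H Q (\<star>)"
  shows "f a \<in> Q" "f Hy2 = f Hy1" "f a \<star> f b = f a"
proof -
  note sym = fixed_sym[OF equiv] and trans = fixed_trans[OF equiv]
  have in_Q: "f a \<in> Q" for a
    by (rule coloring_in[OF f]) (simp add: L2H_def)
  have rel: "f Hx = f Hx \<star> f Hy1" "f Hy2 = f Hy1 \<star> f Hx" "f Hz = f Hz \<star> f Hy2"
    by (rule coloring_crossing[OF f], simp add: L2H_def)+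
  show y: "f Hy2 = f Hy1"
    using rel(2) sym[OF rel(1)[symmetric]] in_Q by simp
  have to_y: "f a \<star> f Hy1 = f a" for a
    using rel(1,3)[symmetric] y in_Q by (cases a) (simp_all add: idem)
  show "f a \<in> Q" by (rule in_Q)
  show "f a \<star> f b = f a"
    using to_y[of a] to_y[of b] sym trans in_Q by metis
qed

text \<open>Cancellation along the clasps settles half of the indices. The outer crossings then
  relate the resulting constants, and this relation settles the other half.\<close>

lemma AS_coloring:
  assumes equiv: "equiv Q {(a, b). a \<in> Q \<and> b \<in> Q \<and> a \<star> b = a}"
    and n: "n > 0"
    and k: "k \<in> colorings (allen_swenberg n) Q (\<star>)"
  shows "\<And>i t. i \<in> {1..2 * n} \<Longrightarrow> k (AS_tangle_arc n i t) = k (T 1 Td)"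
    and "\<And>i. i \<le> 2 * n + 1 \<Longrightarrow> k (X i) = k (X 0)"
    and "k Y2 = k Y1"
    and "k (X 0) \<star> k Y1 = k (X 0)" "k Y1 \<star> k (X 0) = k Y1" "k (T 1 Td) \<star> k Y1 = k (T 1 Td)"
    and "k (T 1 Td) \<in> Q" "k (X 0) \<in> Q" "k Y1 \<in> Q"
proof -
  note sym = fixed_sym[OF equiv] and trans = fixed_trans[OF equiv]
  have in_Q: "k a \<in> Q" if "a \<in> AS_arcs n" for a
    using that by (intro coloring_in[OF k]) (simp add: allen_swenberg_def)
  have X_Q: "k (X i) \<in> Q" if "i \<le> 2 * n + 1" for i
    using that by (intro in_Q X_Y_in_AS_arcs)
  have Y_Q: "k Y1 \<in> Q"
    by (intro in_Q X_Y_in_AS_arcs)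
  have T_Q: "k (AS_tangle_arc n i t) \<in> Q" if "i \<in> {1..2 * n}" for i t
    using that by (intro in_Q tangle_arc_in_AS_arcs)
  have rel: "k c = k a \<star> k b" if "(a \<rhd> b \<doteq> c) \<in> AS_crossings n" for a b c
    using that by (intro coloring_crossing[OF k]) (simp add: allen_swenberg_def)
  have end_p: "AS_tangle_arc n i Tp = T i Tp" "AS_tangle_arc n i Tq = T i Tq"
    "AS_tangle_arc n i Td = T i Td" for i
    by (simp_all add: AS_tangle_arc_def)
  have end_e: "AS_tangle_arc n i Te = T (Suc i) Td" if "i < 2 * n" for i
    using that by (simp add: AS_tangle_arc_def)
  have odd_rel: "k (T i Tq) = k (T i Tp) \<star> k (X i)" "k (X (i - 1)) = k (X i) \<star> k (T i Tp)"
    if "i \<in> {1..2 * n}" "odd i" for i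
    by (rule rel, use that in \<open>force simp: AS_crossings_def\<close>)+
  have even_rel: "k (T i Tp) = k (T i Tq) \<star> k (X (i - 1))" "k (X i) = k (X (i - 1)) \<star> k (T i Tq)"
    if "i \<in> {1..2 * n}" "even i" for i
    by (rule rel, use that in \<open>force simp: AS_crossings_def\<close>)+
  have last_rel: "k (X (2 * n + 1)) = k (X 0) \<star> k (X (2 * n))"
      "k (X (2 * n)) = k (X (2 * n + 1)) \<star> k Y1" "k Y1 = k Y2 \<star> k (X (2 * n))"
      "k Y2 = k Y1 \<star> k (T 1 Td)" "k (T 1 Td) = k (T (2 * n) Te) \<star> k Y1"
    by (rule rel, simp add: AS_crossings_def)+
  have T_Q': "k (T i Tp) \<in> Q" "k (T i Tq) \<in> Q" "k (T i Td) \<in> Q" if "i \<in> {1..2 * n}" for i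
    using T_Q[OF that, of Tp] T_Q[OF that, of Tq] T_Q[OF that, of Td] by (simp_all add: end_p)
  have orb: "k (T i Tq) \<in> orbit (k (T i Tp))" if i: "i \<in> {1..2 * n}" for i
  proof (cases "odd i")
    case True
    then show ?thesis
      using odd_rel(1)[OF i] orbit_mult_iff[of "k (T i Tp)" "k (T i Tp)" "k (X i)"]
        orbit_refl T_Q'[OF i] X_Q[of i] i by simp
  next
    case False
    have "i - 1 \<le> 2 * n + 1" using i by auto
    with False show ?thesis
      using even_rel(1)[OF i] orbit_mult_iff[of "k (T i Tp)" "k (T i Tq)" "k (X (i - 1))"]
        orbit_refl T_Q'[OF i] X_Q[of "i - 1"] by simp
  qed
  have straight: "k (T i Tp) = k (T i Td)" "k (T i Tq) = k (AS_tangle_arc n i Te)"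
    if i: "i \<in> {1..2 * n}" for i
    using tangle_ends[of "\<lambda>t. k (AS_tangle_arc n i t)"] T_Q[OF i] AS_coloring_tangle[OF k i] orb[OF i]
    by (simp_all add: end_p)
  \<comment> \<open>For 1 \<le> i \<le> 2n + 1 this is the value of the i-th vertical strand once
    the tangles are straightened. The last strand is the end e of tangle 2n, as there is no tangle
    2n + 1; hence the second case.\<close>
  define m where "m i = (if i \<le> 2 * n then k (T i Td) else k (T (2 * n) Te))" for i
  have pq: "k (T i Tp) = m i" "k (T i Tq) = m (Suc i)" if i: "i \<in> {1..2 * n}" for i
    using straight[OF i] i end_e[of i]
    by (auto simp: m_def AS_tangle_arc_def not_less_eq_eq dest: le_antisym)
  have m_Q: "m (Suc i) \<in> Q" if "i \<le> 2 * n" for i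
  proof (cases "i = 0")
    case True
    then show ?thesis using T_Q'(3)[of 1] n by (simp add: m_def)
  next
    case False
    then show ?thesis using pq(2)[of i] T_Q'(2)[of i] that by simp
  qed
  \<comment> \<open>Consecutive clasps share an arc: \<open>m\<^sub>i * x\<^sub>i = m\<^sub>i\<^sub>+\<^sub>1 = m\<^sub>i\<^sub>+\<^sub>2 * x\<^sub>i\<close> for odd \<open>i\<close>.\<close>
  have periodic: "m (2 * j + 1) = m 1 \<and> k (X (2 * j)) = k (X 0)" if "j \<le> n" for j
    using that
  proof (induction j)
    case (Suc j)
    let ?i = "2 * j + 1"
    have i: "?i \<in> {1..2 * n}" "Suc ?i \<in> {1..2 * n}" using Suc.prems by auto
    have "m (Suc ?i) = m (Suc (Suc ?i)) \<star> k (X ?i)" "m (Suc ?i) = m ?i \<star> k (X ?i)"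
      using even_rel(1)[OF i(2)] odd_rel(1)[OF i(1)] pq[OF i(1)] pq[OF i(2)] by simp_all
    then have m: "m (Suc (Suc ?i)) = m ?i"
      using right_cancel[of "m (Suc (Suc ?i))" "m ?i" "k (X ?i)"] m_Q[of "Suc ?i"] m_Q[of "2 * j"]
        X_Q[of ?i] i by simp
    \<comment> \<open>The neighbours of x_i are its products with m_(i+2) and m_i, which have just
      been shown equal.\<close>
    have "k (X (Suc ?i)) = k (X ?i) \<star> m (Suc (Suc ?i))" "k (X (2 * j)) = k (X ?i) \<star> m ?i"
      using even_rel(2)[OF i(2)] odd_rel(2)[OF i(1)] pq[OF i(1)] pq[OF i(2)] by simp_all
    then have X: "k (X (Suc ?i)) = k (X (2 * j))"
      by (simp only: m)
    have "2 * Suc j = Suc ?i" "j \<le> n" using Suc.prems by auto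
    with m X Suc.IH show ?case by (simp only: Suc_eq_plus1)
  qed simp
  have m1: "m 1 = k (T 1 Td)" and me: "k (T (2 * n) Te) = m 1"
    using n periodic[of n] by (simp_all add: m_def)
  have m1_Q: "m 1 \<in> Q" using m_Q[of 0] by simp
  have X0_Q: "k (X 0) \<in> Q" using X_Q[of 0] by simp
  have X_last: "k (X (2 * n)) = k (X 0)" "k (X (2 * n + 1)) = k (X 0)"
    using periodic[of n] last_rel(1) idem[OF X0_Q] by simp_all
  have xy: "k (X 0) \<star> k Y1 = k (X 0)"
    using last_rel(2) X_last by simp
  have my: "m 1 \<star> k Y1 = m 1"
    using last_rel(5) m1 me by simp
  have yx: "k Y1 \<star> k (X 0) = k Y1" using sym[OF xy] X0_Q Y_Q by simp
  have ym: "k Y1 \<star> m 1 = k Y1" using sym[OF my] m1_Q Y_Q by simp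
  have xm: "k (X 0) \<star> m 1 = k (X 0)" using trans[OF xy ym] X0_Q Y_Q m1_Q by simp
  have mx: "m 1 \<star> k (X 0) = m 1" using sym[OF xm] X0_Q m1_Q by simp
  show "k Y2 = k Y1" using last_rel(4) ym m1 by simp
  show "k (X 0) \<star> k Y1 = k (X 0)" "k Y1 \<star> k (X 0) = k Y1" "k (T 1 Td) \<star> k Y1 = k (T 1 Td)"
    "k (T 1 Td) \<in> Q" "k (X 0) \<in> Q" "k Y1 \<in> Q"
    using xy yx my m1 m1_Q X0_Q Y_Q by simp_all
  \<comment> \<open>The remaining half: x_i * m_1 = x_0 = x_0 * m_1 cancels to x_i = x_0, and then
    m_(i+1) = m_1 * x_0 = m_1.\<close>
  have odd_const: "k (X i) = k (X 0)" "m (Suc i) = m 1" if i: "i \<in> {1..2 * n}" "odd i" for i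
  proof -
    obtain j where j: "i = 2 * j + 1" using i(2) by (elim oddE)
    have m: "m i = m 1" and X: "k (X (i - 1)) = k (X 0)"
      using periodic[of j] i j by auto
    have "k (X i) \<star> m 1 = k (X 0) \<star> m 1"
      using odd_rel(2)[OF i] pq[OF i(1)] m X xm by simp
    then show *: "k (X i) = k (X 0)"
      using right_cancel X_Q[of i] X0_Q m1_Q i by simp
    show "m (Suc i) = m 1"
      using odd_rel(1)[OF i] pq[OF i(1)] m * mx by simp
  qed
  have m_const: "m (Suc i) = m 1" if "i \<le> 2 * n" for i
  proof (cases "odd i")
    case True
    then show ?thesis using odd_const(2)[of i] that by (cases i) auto
  next
    case False
    then show ?thesis using periodic[of "i div 2"] that by auto
  qed
  show "k (X i) = k (X 0)" if "i \<le> 2 * n + 1" for i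
  proof (cases "odd i")
    case True
    then show ?thesis using odd_const(1)[of i] X_last that by (cases "i = 2 * n + 1") (auto elim: oddE)
  next
    case False
    then show ?thesis using periodic[of "i div 2"] that by auto
  qed
  \<comment> \<open>All four ends of the tangle now carry the value \<open>m 1\<close>.\<close>
  show "k (AS_tangle_arc n i t) = k (T 1 Td)" if i: "i \<in> {1..2 * n}" for i t
  proof -
    have mi: "m i = m 1" using m_const[of "i - 1"] i by (cases i) auto
    have msi: "m (Suc i) = m 1" using m_const[of i] i by simp
    show ?thesis
      using tangle_constant[of "\<lambda>t. k (AS_tangle_arc n i t)" "m 1" t] T_Q[OF i]
        AS_coloring_tangle[OF k i] pq[OF i] straight[OF i] mi msi m1 by (simp add: end_p)
  qed
qed

lemma AS_coloring_component:
  assumes "equiv Q {(a, b). a \<in> Q \<and> b \<in> Q \<and> a \<star> b = a}" "n > 0"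
    and "k \<in> colorings (allen_swenberg n) Q (\<star>)" "a \<in> AS_arcs n"
  shows "k a = (case component a of
    Hx \<Rightarrow> k (X 0) | Hy1 \<Rightarrow> k Y1 | Hy2 \<Rightarrow> k Y1 | Hz \<Rightarrow> k (T 1 Td))"
  using assms(4)
proof (cases rule: AS_arcs_cases)
  case (1 i t)
  then show ?thesis using AS_coloring(1)[OF assms(1-3) 1(1), of t] by simp
next
  case (2 i)
  then show ?thesis using AS_coloring(2)[OF assms(1-3) 2(1)] by simp
qed (simp_all add: AS_coloring(3)[OF assms(1-3)])

lemma AS_coloring_image:
  assumes "equiv Q {(a, b). a \<in> Q \<and> b \<in> Q \<and> a \<star> b = a}" "n > 0"
    and k: "k \<in> colorings (allen_swenberg n) Q (\<star>)"
  shows "k ` AS_arcs n = {k (X 0), k Y1, k (T 1 Td)}"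
proof
  show "k ` AS_arcs n \<subseteq> {k (X 0), k Y1, k (T 1 Td)}"
  proof (rule image_subsetI)
    fix a assume "a \<in> AS_arcs n"
    from AS_coloring_component[OF assms this] show "k a \<in> {k (X 0), k Y1, k (T 1 Td)}"
      by (cases "component a") simp_all
  qed
  show "{k (X 0), k Y1, k (T 1 Td)} \<subseteq> k ` AS_arcs n"
    using T_1_Td_in_AS_arcs[OF \<open>n > 0\<close>] by (auto intro: X_Y_in_AS_arcs)
qed

section \<open>The bijection between the colorings\<close>

lemma bij_betw_colorings:
  assumes equiv: "equiv Q {(a, b). a \<in> Q \<and> b \<in> Q \<and> a \<star> b = a}" and n: "n > 0"
  shows "bij_betw (\<lambda>f. restrict (f \<circ> component) (AS_arcs n))
    (colorings L2H Q (\<star>)) (colorings (allen_swenberg n) Q (\<star>))"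
    (is "bij_betw ?F _ _")
proof -
  have arcs: "X 0 \<in> AS_arcs n" "Y1 \<in> AS_arcs n" "Y2 \<in> AS_arcs n" "T 1 Td \<in> AS_arcs n"
    using T_1_Td_in_AS_arcs[OF n] by (auto intro: X_Y_in_AS_arcs)
  \<comment> \<open>The inverse reads a coloring off at one representative arc for each arc of the
    connected sum.\<close>
  define G :: "(AS_arc \<Rightarrow> 'a) \<Rightarrow> L2H_arc \<Rightarrow> 'a" where
    "G k a = (case a of Hx \<Rightarrow> k (X 0) | Hy1 \<Rightarrow> k Y1 | Hy2 \<Rightarrow> k Y2 | Hz \<Rightarrow> k (T 1 Td))" for k a
  have "G (?F f) = f" for f
    using arcs by (auto simp: G_def fun_eq_iff split: L2H_arc.split)
  moreover have "?F (G k) = k" if k: "k \<in> colorings (allen_swenberg n) Q (\<star>)" for k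
  proof
    fix a
    show "?F (G k) a = k a"
    proof (cases "a \<in> AS_arcs n")
      case True
      then show ?thesis
        using AS_coloring_component[OF equiv n k True] AS_coloring(3)[OF equiv n k]
        by (simp add: G_def split: L2H_arc.split)
    next
      case False
      then show ?thesis
        using k PiE_arb[of k "AS_arcs n" "\<lambda>_. Q" a]
        by (simp add: colorings_def allen_swenberg_def)
    qed
  qed
  moreover have "?F f \<in> colorings (allen_swenberg n) Q (\<star>)" if f: "f \<in> colorings L2H Q (\<star>)" for f
  proof -
    note L = L2H_coloring[OF equiv f]
    have mult: "f a \<star> f b = f a" for a b by (rule L(3))
    \<comment> \<open>Any two values of \<open>f\<close> are related, so a pulled-back crossing
      relation only asks its two under-arcs to have equal values.\<close>
    have comp: "f (component (right_arc c)) = f (component (left_arc c))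
        \<and> left_arc c \<in> AS_arcs n \<and> over_arc c \<in> AS_arcs n \<and> right_arc c \<in> AS_arcs n"
      if "c \<in> AS_crossings n" for c
    proof -
      from that consider
          (tangle) i c' where "i \<in> {1..2 * n}" "c = map_crossing (AS_tangle_arc n i) c'"
        | (clasp) i where "i \<in> {1..2 * n}"
            "c \<in> {T i Tp \<rhd> X i \<doteq> T i Tq, X i \<rhd> T i Tp \<doteq> X (i - 1),
              T i Tq \<rhd> X (i - 1) \<doteq> T i Tp, X (i - 1) \<rhd> T i Tq \<doteq> X i}"
        | (outer) "c \<in> {X 0 \<rhd> X (2 * n) \<doteq> X (2 * n + 1), X (2 * n + 1) \<rhd> Y1 \<doteq> X (2 * n),
              Y2 \<rhd> X (2 * n) \<doteq> Y1, Y1 \<rhd> T 1 Td \<doteq> Y2, T (2 * n) Te \<rhd> Y1 \<doteq> T 1 Td}"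
        by (auto simp: AS_crossings_def)
      then show ?thesis
      proof cases
        case tangle
        then show ?thesis
          by (simp add: crossing.map_sel tangle_arc_in_AS_arcs)
      next
        case clasp
        have "T i Tp \<in> AS_arcs n" "T i Tq \<in> AS_arcs n"
          using tangle_arc_in_AS_arcs[OF clasp(1), of Tp] tangle_arc_in_AS_arcs[OF clasp(1), of Tq]
          by (simp_all add: AS_tangle_arc_def)
        moreover have "X i \<in> AS_arcs n" "X (i - 1) \<in> AS_arcs n"
          by (rule X_Y_in_AS_arcs(1), use clasp(1) in auto)+
        ultimately show ?thesis using clasp(2) by auto
      next
        case outer
        have "T (2 * n) Te \<in> AS_arcs n"
          using tangle_arc_in_AS_arcs[of "2 * n" n Te] n by (simp add: AS_tangle_arc_def)
        with outer arcs show ?thesis by (auto simp: L(2) X_Y_in_AS_arcs)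
      qed
    qed
    have "?F f \<in> AS_arcs n \<rightarrow>\<^sub>E Q"
      using L(1) by auto
    then show ?thesis
      using comp by (auto simp: colorings_def allen_swenberg_def mult)
  qed
  moreover have "G k \<in> colorings L2H Q (\<star>)" if k: "k \<in> colorings (allen_swenberg n) Q (\<star>)" for k
    using AS_coloring(3-9)[OF equiv n k]
      fixed_sym[OF equiv AS_coloring(6,7,9)[OF equiv n k]]
    by (auto simp: colorings_def L2H_def G_def split: L2H_arc.split)
  ultimately show ?thesis
    by (intro bij_betw_byWitness[where f' = G]) auto
qed

end

theorem proposition3p1:
  fixes Q :: "'q set" and qop :: "'q \<Rightarrow> 'q \<Rightarrow> 'q" and n :: nat
  assumes "medial_quandle Q qop"
    and "finite Q"
    and "equiv Q {(a, b). a \<in> Q \<and> b \<in> Q \<and> qop a b = a}"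
    and "n > 0"
  shows "card (colorings (allen_swenberg n) Q qop) = card (colorings L2H Q qop) \<and>
         enhanced_coloring_poly (allen_swenberg n) Q qop = enhanced_coloring_poly L2H Q qop"
proof -
  interpret medial_quandle Q qop by (rule assms(1))
  note bij = bij_betw_colorings[OF assms(3,4)]
  \<comment> \<open>The bijection preserves the size of the image, so reindexing along it matches
    the two polynomials term by term.\<close>
  have "card (restrict (f \<circ> component) (AS_arcs n) ` arcs (allen_swenberg n)) = card (f ` arcs L2H)"
    if f: "f \<in> colorings L2H Q qop" for f
  proof -
    let ?k = "restrict (f \<circ> component) (AS_arcs n)"
    have k: "?k \<in> colorings (allen_swenberg n) Q qop"
      using bij f by (rule bij_betw_apply)
    have "X 0 \<in> AS_arcs n" "Y1 \<in> AS_arcs n" "T 1 Td \<in> AS_arcs n"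
      using T_1_Td_in_AS_arcs[OF assms(4)] by (auto intro: X_Y_in_AS_arcs)
    then have "?k ` AS_arcs n = {f Hx, f Hy1, f Hz}"
      using AS_coloring_image[OF assms(3,4) k] by simp
    also have "\<dots> = f ` {Hx, Hy1, Hy2, Hz}"
      using L2H_coloring(2)[OF assms(3) f] by auto
    also have "{Hx, Hy1, Hy2, Hz} = UNIV"
      using L2H_arc.exhaust by blast
    finally show ?thesis
      by (simp add: allen_swenberg_def L2H_def)
  qed
  then have "enhanced_coloring_poly L2H Q qop = enhanced_coloring_poly (allen_swenberg n) Q qop"
    unfolding enhanced_coloring_poly_def by (simp flip: sum.reindex_bij_betw[OF bij])
  with bij_betw_same_card[OF bij] show ?thesis
    by simp
qed

end
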